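(* Let $X$ be a subset of $\{2,\ldots,n\}$, and set $L:=\{x-1 : x\in X\}$. The set $X$ is equal to $\mathrm{Row}_2(P(w))$ for some boolean permutation $w\in S_n$ if and only if $L\cup\{0\}$ is uncrowded.
   Context: A set $L$ of integers is uncrowded if $|[y,y+2x]\cap L|\le x+1$ for all integers $x,y$ with $x>0$. A word $i_1\cdots i_\ell$ is a reduced word of $w\in S_n$ if $w=s_{i_1}\cdots s_{i_\ell}$ with $\ell$ minimal, where $s_i$ is the adjacent transposition swapping $i$ and $i+1$. A permutation is boolean if some (equivalently, every) reduced word of it consists of distinct letters. Equivalently, it avoids the patterns $321$ and $3412$. $P(w)$ is the insertion tableau of $w$ (in one-line notation $w(1)\cdots w(n)$) under the Robinson–Schensted–Knuth (row insertion) correspondence, and $\mathrm{Row}_2(T)$ is the set of entries in the second row of a tableau $T$ (empty if $T$ has only one row). *)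

theory Defs
  imports "HOL-Combinatorics.Permutations"
begin

definition uncrowded :: "int set \<Rightarrow> bool" where
  "uncrowded L \<longleftrightarrow> (\<forall>x y. 0 < x \<longrightarrow> int (card ({y..y + 2 * x} \<inter> L)) \<le> x + 1)"

text \<open>
  Elements of the symmetric group on \<open>{1..n}\<close> are functions \<open>w :: nat \<Rightarrow> nat\<close> with
  \<open>w permutes {1..n}\<close>; products are compositions of functions (rightmost factor acts first).
\<close>

definition adj_transp :: "nat \<Rightarrow> nat \<Rightarrow> nat" where
  "adj_transp i = Transposition.transpose i (i + 1)"

definition word_prod :: "nat list \<Rightarrow> nat \<Rightarrow> nat" where
  "word_prod u = foldr (\<lambda>i f. adj_transp i \<circ> f) u id"

definition is_word_of :: "nat \<Rightarrow> (nat \<Rightarrow> nat) \<Rightarrow> nat list \<Rightarrow> bool" where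
  "is_word_of n w u \<longleftrightarrow> set u \<subseteq> {1..<n} \<and> word_prod u = w"

definition reduced_word :: "nat \<Rightarrow> (nat \<Rightarrow> nat) \<Rightarrow> nat list \<Rightarrow> bool" where
  "reduced_word n w u \<longleftrightarrow>
     is_word_of n w u \<and> (\<forall>v. is_word_of n w v \<longrightarrow> length u \<le> length v)"

definition boolean_perm :: "nat \<Rightarrow> (nat \<Rightarrow> nat) \<Rightarrow> bool" where
  "boolean_perm n w \<longleftrightarrow> w permutes {1..n} \<and> (\<exists>u. reduced_word n w u \<and> distinct u)"

text \<open>
  A tableau is the list of its rows, top row first. Inserting \<open>x\<close> into a row replaces the
  leftmost entry greater than \<open>x\<close> and returns that entry as \<open>Some y\<close>; if there is none,
  \<open>x\<close> is appended and \<open>None\<close> is returned.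
\<close>

fun row_insert :: "nat \<Rightarrow> nat list \<Rightarrow> nat option \<times> nat list" where
  "row_insert x [] = (None, [x])"
| "row_insert x (y # ys) =
     (if x < y then (Some y, x # ys)
      else (let (b, zs) = row_insert x ys in (b, y # zs)))"

fun tableau_insert :: "nat \<Rightarrow> nat list list \<Rightarrow> nat list list" where
  "tableau_insert x [] = [[x]]"
| "tableau_insert x (r # rs) =
     (case row_insert x r of
        (None, r') \<Rightarrow> r' # rs
      | (Some y, r') \<Rightarrow> r' # tableau_insert y rs)"

definition insertion_tableau :: "nat \<Rightarrow> (nat \<Rightarrow> nat) \<Rightarrow> nat list list" where
  "insertion_tableau n w = fold tableau_insert (map w [1..<n + 1]) []"

definition Row2 :: "nat list list \<Rightarrow> nat set" where
  "Row2 T = (if 2 \<le> length T then set (T ! 1) else {})"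

end

theory Submission
  imports Defs "HOL-Library.Multiset"
begin

text \<open>
  Both sides of the equivalence are described by a process that reads \<open>1, 2, 3, \<dots>\<close> and decides
  for each number whether it belongs to \<open>Y = X \<union> {1}\<close>, the translate of \<open>L \<union> {0}\<close> by one.

  Give each element of \<open>Y\<close> weight \<open>1\<close> and each other number weight \<open>-1\<close>. An interval of odd length
  \<open>2 * x + 1\<close> contains at most \<open>x + 1\<close> elements of \<open>Y\<close> iff its weight is at most \<open>1\<close>. Enlarging an
  interval of even length by one number changes its weight by one, so \<open>Y\<close> is uncrowded iff all
  intervals have weight at most \<open>2\<close>. The largest weight of a (possibly empty) interval ending at
  \<open>n\<close>, \<open>surplus Y n\<close>, can be updated from \<open>n\<close> to \<open>n + 1\<close>: it goes up by one if \<open>n + 1\<close> is in \<open>Y\<close>,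
  and otherwise goes down by one but not below \<open>0\<close>. Hence uncrowded means that \<open>surplus\<close> never
  exceeds \<open>2\<close> (\<open>uncrowded_iff_surplus_le_2\<close>).

  On the permutation side, words with distinct letters are automatically reduced, and the generator
  \<open>s\<^sub>n\<close> of \<open>S\<^sub>n\<^sub>+\<^sub>1\<close> occurs at most once in such a word. As it commutes with every letter but
  \<open>s\<^sub>n\<^sub>-\<^sub>1\<close>, which also occurs at most once, it can be moved to an end of the word. So a boolean
  permutation of \<open>{1..n + 1}\<close> arises from one of \<open>{1..n}\<close> by one of three moves on the one-line
  notation: append \<open>n + 1\<close>; insert \<open>n + 1\<close> before the last entry; rename \<open>n\<close> to \<open>n + 1\<close> and append
  \<open>n\<close> (\<open>bool_word_iff_boolean_perm\<close>).

  Let \<open>B\<close> be the set of entries bumped from the first row. For boolean permutations they are bumped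
  in increasing order, so they form the whole second row. The effect of a move on \<open>B\<close> depends only
  on whether \<open>n \<in> B\<close> and on whether the last insertion bumped an entry:
  \<^item> appending \<open>n + 1\<close> keeps \<open>B\<close>, and the last insertion no longer bumps;
  \<^item> inserting \<open>n + 1\<close> before the last entry keeps \<open>B\<close> if the last entry bumped before, and adds
    \<open>n + 1\<close> to \<open>B\<close> if it did not; now it bumps in either case;
  \<^item> renaming and appending \<open>n\<close> adds \<open>n + 1\<close> to \<open>B\<close> with a final bump if \<open>n \<notin> B\<close>, and replaces
    \<open>n\<close> by \<open>n + 1\<close> in \<open>B\<close> without a final bump if \<open>n \<in> B\<close>.

  Comparing these rules with the recursion of \<open>surplus\<close>, an induction on \<open>n\<close> shows that the surplus
  of \<open>B \<union> {1}\<close> stays at most \<open>2\<close>, and that it is at most \<open>1\<close> at \<open>n\<close> if there is no final bump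
  (\<open>surplus_of_bool_word\<close>). Conversely every set whose surplus stays at most \<open>2\<close> is such a set
  \<open>B\<close>, and a final bump can be avoided if the surplus at \<open>n\<close> is at most \<open>1\<close>
  (\<open>bool_word_of_surplus\<close>).
\<close>

section \<open>Uncrowded sets and suffix surpluses\<close>

text \<open>
  The largest weight of a final segment of \<open>{1..n}\<close>, where elements of \<open>Y\<close> weigh \<open>1\<close> and other
  numbers \<open>-1\<close>. Truncated subtraction accounts for the empty segment.
\<close>
fun surplus :: "nat set \<Rightarrow> nat \<Rightarrow> nat" where
  "surplus Y 0 = 0"
| "surplus Y (Suc n) = (if Suc n \<in> Y then Suc (surplus Y n) else surplus Y n - 1)"

lemma surplus_cong:
  assumes "Y \<inter> {..n} = Z \<inter> {..n}"
  shows "surplus Y n = surplus Z n"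
  using assms
proof (induction n)
  case 0
  then show ?case by simp
next
  case (Suc n)
  from Suc.prems have "Y \<inter> {..n} = Z \<inter> {..n}" "Suc n \<in> Y \<longleftrightarrow> Suc n \<in> Z"
    by (fastforce simp: set_eq_iff)+
  then show ?case using Suc.IH by simp
qed

text \<open>
  The weight of the interval \<open>{a<..b}\<close>.
\<close>
definition excess :: "nat set \<Rightarrow> nat \<Rightarrow> nat \<Rightarrow> int" where
  "excess Y a b = 2 * int (card (Y \<inter> {a<..b})) - (int b - int a)"

lemma excess_Suc:
  assumes "a \<le> b"
  shows "excess Y a (Suc b) = excess Y a b + (if Suc b \<in> Y then 1 else -1)"
proof -
  have "{a<..Suc b} = insert (Suc b) {a<..b}" using assms by auto
  then show ?thesis by (auto simp: excess_def Int_insert_right)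
qed

lemma excess_le_surplus: "a \<le> b \<Longrightarrow> excess Y a b \<le> int (surplus Y b)"
proof (induction b)
  case 0
  then show ?case by (simp add: excess_def)
next
  case (Suc b)
  show ?case
  proof (cases "a = Suc b")
    case True
    then show ?thesis by (simp add: excess_def)
  next
    case False
    then have "a \<le> b" using Suc.prems by simp
    with Suc.IH excess_Suc[of a b Y] show ?thesis by auto
  qed
qed

text \<open>
  Together with \<open>excess_le_surplus\<close> this identifies the surplus as a maximum. When the truncation
  takes effect, the maximum is attained by the empty segment.
\<close>
lemma surplus_attained: "\<exists>a\<le>b. int (surplus Y b) = excess Y a b"
proof (induction b)
  case 0
  then show ?case by (simp add: excess_def)
next
  case (Suc b)
  then obtain a where a: "a \<le> b" "int (surplus Y b) = excess Y a b" by blast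
  show ?case
  proof (cases "Suc b \<notin> Y \<and> surplus Y b = 0")
    case True
    then show ?thesis by (intro exI[of _ "Suc b"]) (simp add: excess_def)
  next
    case False
    then have "int (surplus Y (Suc b)) = excess Y a (Suc b)"
      using a excess_Suc[OF a(1), of Y] by auto
    then show ?thesis using a(1) le_SucI by blast
  qed
qed

text \<open>
  The surplus grows in steps of one, so if it ever exceeds \<open>2\<close> it equals \<open>3\<close> somewhere; the interval
  attaining it has odd length and violates the condition. Conversely, an interval of odd
  length \<open>2 * x + 1\<close> and weight at most \<open>2\<close> contains at most \<open>x + 3/2\<close>, hence at most \<open>x + 1\<close>, elements.
\<close>
lemma uncrowded_iff_surplus_le_2:
  assumes Y: "0 \<notin> Y"
  shows "uncrowded ((\<lambda>x. int x - 1) ` Y) \<longleftrightarrow> (\<forall>k. surplus Y k \<le> 2)"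
proof -
  \<comment> \<open>Intervals may start below \<open>0\<close>; \<open>nat\<close> cuts off a part that contains no element of \<open>Y\<close>.\<close>
  have window: "card ({y..y + 2 * x} \<inter> (\<lambda>x. int x - 1) ` Y)
      = card (Y \<inter> {nat y<..nat (y + 2 * x + 1)})" for x y :: int
  proof -
    have "{y..y + 2 * x} \<inter> (\<lambda>x. int x - 1) ` Y
        = (\<lambda>x. int x - 1) ` (Y \<inter> {nat y<..nat (y + 2 * x + 1)})" (is "?l = ?f ` ?r")
    proof -
      have "int z - 1 \<in> {y..y + 2 * x} \<longleftrightarrow> z \<in> {nat y<..nat (y + 2 * x + 1)}" if "z \<in> Y" for z
      proof -
        have "0 < z" using that Y by (metis gr0I)
        then show ?thesis by auto
      qed
      then show ?thesis by blast
    qed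
    moreover have "inj_on ?f ?r" by (simp add: inj_on_def)
    ultimately show ?thesis by (metis card_image)
  qed
  show ?thesis
  proof
    assume u: "uncrowded ((\<lambda>x. int x - 1) ` Y)"
    show "\<forall>k. surplus Y k \<le> 2"
    proof
      fix k
      show "surplus Y k \<le> 2"
      proof (induction k)
        case 0
        then show ?case by simp
      next
        case (Suc k)
        show ?case
        proof (rule ccontr)
          assume "\<not> surplus Y (Suc k) \<le> 2"
          then have three: "surplus Y (Suc k) = 3" using Suc.IH by (auto split: if_splits)
          obtain a where a: "a \<le> Suc k" "excess Y a (Suc k) = 3"
            using surplus_attained[of "Suc k" Y] three by auto
          \<comment> \<open>Weight \<open>3\<close> means \<open>c = x + 2\<close> elements in an interval of length \<open>2 * x + 1\<close>.\<close>
          define c where "c = card (Y \<inter> {a<..Suc k})"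
          define x where "x = int c - 2"
          have len: "int (Suc k) - int a = 2 * x + 1"
            using a(2) by (simp add: excess_def c_def x_def)
          \<comment> \<open>An interval with one element weighs at most \<open>1\<close>, so here \<open>x\<close> cannot be \<open>0\<close>.\<close>
          have "c \<le> card {a<..Suc k}" unfolding c_def by (intro card_mono) auto
          then have "0 < x" using len a(1) by (simp add: x_def of_nat_diff)
          then have "int (card ({int a..int a + 2 * x} \<inter> (\<lambda>x. int x - 1) ` Y)) \<le> x + 1"
            using u by (simp add: uncrowded_def)
          moreover have "nat (int a + 2 * x + 1) = Suc k" using len by simp
          ultimately have "int c \<le> x + 1" unfolding window by (simp add: c_def)
          then show False by (simp add: x_def)
        qed
      qed
    qed
  next
    assume s: "\<forall>k. surplus Y k \<le> 2"
    show "uncrowded ((\<lambda>x. int x - 1) ` Y)"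
      unfolding uncrowded_def window
    proof (intro allI impI)
      fix x y :: int
      assume x: "0 < x"
      define a b where "a = nat y" and "b = nat (y + 2 * x + 1)"
      have "a \<le> b" "int b - int a \<le> 2 * x + 1" using x by (auto simp: a_def b_def)
      moreover have "excess Y a b \<le> 2"
        using excess_le_surplus[OF \<open>a \<le> b\<close>, of Y] s[rule_format, of b] by linarith
      ultimately show "int (card (Y \<inter> {nat y<..nat (y + 2 * x + 1)})) \<le> x + 1"
        unfolding a_def[symmetric] b_def[symmetric] excess_def by linarith
    qed
  qed
qed

section \<open>Boolean permutations grown one letter at a time\<close>

text \<open>
  On \<open>{1..n}\<close> this renames \<open>n\<close> to \<open>n + 1\<close>. The larger values are shifted only to make the function
  strictly monotone everywhere, which is what compatibility with row insertion requires.
\<close>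
definition lift_from :: "nat \<Rightarrow> nat \<Rightarrow> nat" where
  "lift_from n x = (if x < n then x else Suc x)"

text \<open>
  The one-line notations of boolean permutations of \<open>{1..n}\<close> for \<open>n > 0\<close>. With \<open>s\<^sub>n\<close> the transposition of \<open>n\<close>
  and \<open>n + 1\<close>, the last three rules lead from \<open>w\<close> to \<open>w\<close>, \<open>w \<circ> s\<^sub>n\<close> and \<open>s\<^sub>n \<circ> w\<close> in \<open>S\<^sub>n\<^sub>+\<^sub>1\<close>.
\<close>
inductive bool_word :: "nat \<Rightarrow> nat list \<Rightarrow> bool" where
  single: "bool_word 1 [1]"
| append_max: "bool_word n xs \<Longrightarrow> bool_word (Suc n) (xs @ [Suc n])"
| max_before_last: "bool_word n (xs @ [m]) \<Longrightarrow> bool_word (Suc n) (xs @ [Suc n, m])"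
| swap_top_values: "bool_word n xs \<Longrightarrow> bool_word (Suc n) (map (lift_from n) xs @ [n])"

lemma bool_word_pos: "bool_word n xs \<Longrightarrow> 0 < n"
  by (induction rule: bool_word.induct) auto

lemma word_prod_simps [simp]:
  "word_prod [] = id"
  "word_prod (i # u) = adj_transp i \<circ> word_prod u"
  by (simp_all add: word_prod_def)

lemma word_prod_append: "word_prod (u @ v) = word_prod u \<circ> word_prod v"
  by (induction u) (simp_all add: comp_assoc)

lemma adj_transp_simps [simp]:
  "adj_transp i i = Suc i" "adj_transp i (Suc i) = i"
  "x \<noteq> i \<Longrightarrow> x \<noteq> Suc i \<Longrightarrow> adj_transp i x = x"
  by (auto simp: adj_transp_def transpose_def)

lemma word_prod_permutes: "set u \<subseteq> {1..<n} \<Longrightarrow> word_prod u permutes {1..n}"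
proof (induction u)
  case Nil
  show ?case unfolding word_prod_simps by (rule permutes_id)
next
  case (Cons i u)
  have "adj_transp i permutes {1..n}"
    using Cons.prems unfolding adj_transp_def by (intro permutes_swap_id) auto
  then show ?case
    unfolding word_prod_simps using Cons by (intro permutes_compose) auto
qed

lemma adj_transp_commute:
  assumes "k \<noteq> i" "k \<noteq> Suc i" "i \<noteq> Suc k"
  shows "adj_transp i \<circ> adj_transp k = adj_transp k \<circ> adj_transp i"
  using assms by (auto simp: fun_eq_iff adj_transp_def transpose_def)

lemma adj_transp_commute_word:
  assumes "\<forall>k\<in>set u. k \<noteq> i \<and> k \<noteq> Suc i \<and> i \<noteq> Suc k"
  shows "adj_transp i \<circ> word_prod u = word_prod u \<circ> adj_transp i"
  using assms
proof (induction u)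
  case Nil
  then show ?case by simp
next
  case (Cons k u)
  have k: "adj_transp i \<circ> adj_transp k = adj_transp k \<circ> adj_transp i"
    using Cons.prems by (intro adj_transp_commute) auto
  have IH: "adj_transp i \<circ> word_prod u = word_prod u \<circ> adj_transp i"
    using Cons.prems by (intro Cons.IH) simp
  have "adj_transp i \<circ> word_prod (k # u) = (adj_transp k \<circ> adj_transp i) \<circ> word_prod u"
    unfolding word_prod_simps comp_assoc[symmetric] k ..
  also have "\<dots> = word_prod (k # u) \<circ> adj_transp i"
    unfolding word_prod_simps comp_assoc IH ..
  finally show ?case .
qed

lemma word_prod_preserves_initial_segment:
  assumes "i \<notin> set v"
  shows "word_prod v ` {..i} = {..i}"
  using assms
proof (induction v)
  case Nil
  then show ?case by simp
next
  case (Cons k v)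
  have "adj_transp k ` {..i} = {..i}"
    using Cons.prems unfolding adj_transp_def by (subst transpose_image_eq) auto
  then show ?case
    unfolding word_prod_simps image_comp[symmetric] using Cons by simp
qed

text \<open>
  Among the factors only \<open>s\<^sub>i\<close>, which occurs exactly once, moves \<open>{..i}\<close>. By the preceding lemma,
  every word for the same permutation must then contain \<open>i\<close>; this is why words with distinct letters
  are reduced.
\<close>
lemma distinct_word_moves_initial_segments:
  assumes "distinct u" "i \<in> set u"
  shows "word_prod u ` {..i} \<noteq> {..i}"
proof
  assume eq: "word_prod u ` {..i} = {..i}"
  obtain a b where u: "u = a @ i # b" using assms(2) by (meson split_list)
  then have notin: "i \<notin> set a" "i \<notin> set b" using assms(1) by auto
  have inj: "inj (word_prod v)" for v
  proof (induction v)
    case (Cons k v)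
    then show ?case
      unfolding word_prod_simps adj_transp_def by (intro inj_compose) auto
  qed simp
  have "word_prod u ` {..i} = word_prod a ` adj_transp i ` word_prod b ` {..i}"
    by (simp add: u word_prod_append image_comp comp_assoc)
  then have "word_prod a ` adj_transp i ` {..i} = word_prod a ` {..i}"
    using eq word_prod_preserves_initial_segment[OF notin(1)]
      word_prod_preserves_initial_segment[OF notin(2)] by simp
  then have "adj_transp i ` {..i} = {..i}" by (simp add: inj_image_eq_iff[OF inj])
  moreover have "adj_transp i i \<in> adj_transp i ` {..i}" by blast
  ultimately show False by simp
qed

lemma boolean_perm_iff_distinct_word:
  "boolean_perm n w \<longleftrightarrow> (\<exists>u. distinct u \<and> set u \<subseteq> {1..<n} \<and> word_prod u = w)"
proof
  assume "boolean_perm n w"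
  then show "\<exists>u. distinct u \<and> set u \<subseteq> {1..<n} \<and> word_prod u = w"
    by (auto simp: boolean_perm_def reduced_word_def is_word_of_def)
next
  assume "\<exists>u. distinct u \<and> set u \<subseteq> {1..<n} \<and> word_prod u = w"
  then obtain u where u: "distinct u" "set u \<subseteq> {1..<n}" "word_prod u = w" by blast
  have "length u \<le> length v" if "word_prod v = w" for v
  proof -
    have "set u \<subseteq> set v"
    proof
      fix i
      assume "i \<in> set u"
      then have "word_prod v ` {..i} \<noteq> {..i}"
        using distinct_word_moves_initial_segments[OF u(1)] u(3) that by simp
      then show "i \<in> set v" using word_prod_preserves_initial_segment by metis
    qed
    then have "card (set u) \<le> card (set v)" by (simp add: card_mono)
    then show ?thesis using distinct_card[OF u(1)] card_length[of v] by linarith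
  qed
  then show "boolean_perm n w"
    using u word_prod_permutes[of u n]
    by (auto simp: boolean_perm_def reduced_word_def is_word_of_def)
qed

lemma one_line_append_max:
  assumes "w permutes {1..n}"
  shows "map w [1..<Suc n + 1] = map w [1..<n + 1] @ [Suc n]"
  using assms by (simp add: permutes_def)

lemma one_line_swap_last_positions:
  assumes "w permutes {1..n}" "0 < n"
  shows "map (w \<circ> adj_transp n) [1..<Suc n + 1] = map w [1..<n] @ [Suc n, w n]"
proof -
  have "map (w \<circ> adj_transp n) [1..<n] = map w [1..<n]" by auto
  moreover have "w (Suc n) = Suc n" using assms(1) by (simp add: permutes_def)
  ultimately show ?thesis using assms(2) by (simp add: Suc_le_eq)
qed

lemma one_line_swap_top_values:
  assumes "w permutes {1..n}"
  shows "map (adj_transp n \<circ> w) [1..<Suc n + 1] = map (lift_from n) (map w [1..<n + 1]) @ [n]"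
proof -
  have "adj_transp n (w x) = lift_from n (w x)" if "x \<in> {1..n}" for x
  proof -
    have "w x \<in> {1..n}" using permutes_in_image[OF assms] that by simp
    then show ?thesis by (cases "w x = n") (auto simp: lift_from_def)
  qed
  moreover have "w (Suc n) = Suc n" using assms by (simp add: permutes_def)
  ultimately show ?thesis by auto
qed

text \<open>
  The letter \<open>n\<close> commutes with all others except \<open>n - 1\<close>, which lies on at most one side of it.
  Moving \<open>n\<close> to the end of the word on the other side exhibits the permutation as \<open>w \<circ> s\<^sub>n\<close> or
  \<open>s\<^sub>n \<circ> w\<close> with \<open>w\<close> boolean on \<open>{1..n}\<close>.
\<close>
lemma bool_word_of_distinct_word:
  assumes "0 < n" "distinct u" "set u \<subseteq> {1..<n}"
  shows "bool_word n (map (word_prod u) [1..<n + 1])"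
  using assms
proof (induction n arbitrary: u)
  case 0
  then show ?case by simp
next
  case (Suc n)
  show ?case
  proof (cases "n = 0")
    case True
    then show ?thesis using Suc.prems bool_word.single by simp
  next
    case n: False
    show ?thesis
    proof (cases "n \<in> set u")
      case False
      then have "set u \<subseteq> {1..<n}" using Suc.prems by (force simp: less_Suc_eq)
      then have "bool_word n (map (word_prod u) [1..<n + 1])" "word_prod u permutes {1..n}"
        using Suc.IH[of u] Suc.prems(2) n word_prod_permutes by auto
      then show ?thesis using bool_word.append_max one_line_append_max by metis
    next
      case True
      then obtain a b where u: "u = a @ n # b" by (meson split_list)
      have ab: "distinct (a @ b)" "set (a @ b) \<subseteq> {1..<n}"
        using Suc.prems u by (force simp: less_Suc_eq)+
      define w where "w = word_prod (a @ b)"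
      have w: "w permutes {1..n}" using word_prod_permutes[OF ab(2)] by (simp add: w_def)
      have IH: "bool_word n (map w [1..<n + 1])" using Suc.IH[OF _ ab] n by (simp add: w_def)
      show ?thesis
      proof (cases "n - 1 \<in> set b")
        case False
        then have "\<forall>k\<in>set b. k \<noteq> n \<and> k \<noteq> Suc n \<and> n \<noteq> Suc k" using ab(2) by force
        then have "adj_transp n \<circ> word_prod b = word_prod b \<circ> adj_transp n"
          by (rule adj_transp_commute_word)
        then have "word_prod u = w \<circ> adj_transp n"
          by (simp add: u w_def word_prod_append comp_assoc)
        moreover have "bool_word n (map w [1..<n] @ [w n])" using IH n by simp
        ultimately show ?thesis
          using one_line_swap_last_positions[OF w] n bool_word.max_before_last by (metis gr0I)
      next
        case True
        then have "\<forall>k\<in>set a. k \<noteq> n \<and> k \<noteq> Suc n \<and> n \<noteq> Suc k" using ab by force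
        then have "adj_transp n \<circ> word_prod a = word_prod a \<circ> adj_transp n"
          by (rule adj_transp_commute_word)
        then have "word_prod u = adj_transp n \<circ> w"
          unfolding u w_def word_prod_append word_prod_simps by (metis comp_assoc)
        then show ?thesis
          using one_line_swap_top_values[OF w] bool_word.swap_top_values[OF IH] by metis
      qed
    qed
  qed
qed

lemma distinct_word_of_bool_word:
  "bool_word n xs \<Longrightarrow>
    \<exists>u. distinct u \<and> set u \<subseteq> {1..<n} \<and> xs = map (word_prod u) [1..<n + 1]"
proof (induction rule: bool_word.induct)
  case single
  then show ?case by (intro exI[of _ "[]"]) simp
next
  case (append_max n xs)
  then obtain u where u: "distinct u" "set u \<subseteq> {1..<n}" "xs = map (word_prod u) [1..<n + 1]"
    by blast
  then show ?case
    using one_line_append_max[OF word_prod_permutes[OF u(2)]] by (intro exI[of _ u]) auto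
next
  case (max_before_last n xs m)
  then obtain u where u: "distinct u" "set u \<subseteq> {1..<n}"
      "xs @ [m] = map (word_prod u) [1..<n + 1]"
    by blast
  have n: "0 < n" using bool_word_pos max_before_last.hyps by blast
  have "xs = map (word_prod u) [1..<n]" "m = word_prod u n" using u(3) n by auto
  then have "xs @ [Suc n, m] = map (word_prod (u @ [n])) [1..<Suc n + 1]"
    using one_line_swap_last_positions[OF word_prod_permutes[OF u(2)] n]
    by (simp add: word_prod_append)
  moreover have "distinct (u @ [n])" "set (u @ [n]) \<subseteq> {1..<Suc n}" using u n by auto
  ultimately show ?case by blast
next
  case (swap_top_values n xs)
  then obtain u where u: "distinct u" "set u \<subseteq> {1..<n}" "xs = map (word_prod u) [1..<n + 1]"
    by blast
  have n: "0 < n" using bool_word_pos swap_top_values.hyps by blast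
  have "map (lift_from n) xs @ [n] = map (word_prod (n # u)) [1..<Suc n + 1]"
    unfolding u(3) word_prod_simps
    using one_line_swap_top_values[OF word_prod_permutes[OF u(2)]] by metis
  moreover have "distinct (n # u)" "set (n # u) \<subseteq> {1..<Suc n}" using u n by auto
  ultimately show ?case by blast
qed

lemma bool_word_iff_boolean_perm:
  assumes "0 < n"
  shows "bool_word n xs \<longleftrightarrow> (\<exists>w. boolean_perm n w \<and> xs = map w [1..<n + 1])"
  using bool_word_of_distinct_word[OF assms] distinct_word_of_bool_word[of n xs]
  unfolding boolean_perm_iff_distinct_word by blast

lemma bool_word_letters: "bool_word n xs \<Longrightarrow> set xs = {1..n} \<and> distinct xs"
proof -
  assume "bool_word n xs"
  then obtain u where u: "set u \<subseteq> {1..<n}" "xs = map (word_prod u) [1..<n + 1]"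
    using distinct_word_of_bool_word by blast
  have p: "word_prod u permutes {1..n}" by (rule word_prod_permutes[OF u(1)])
  have "{1..<n + 1} = {1..n}" by auto
  then show ?thesis
    using permutes_image[OF p] permutes_inj_on[OF p]
    by (simp add: u(2) distinct_map del: upt_Suc)
qed

lemma bool_word_le: "bool_word n xs \<Longrightarrow> x \<in> set xs \<Longrightarrow> x \<le> n"
  using bool_word_letters by fastforce

section \<open>Entries bumped out of the first row\<close>

text \<open>
  Insertion into the first row alone. The state consists of the row and the list of entries bumped so far,
  in the order in which they pass to the lower rows.
\<close>
definition row_step :: "nat \<Rightarrow> nat list \<times> nat list \<Rightarrow> nat list \<times> nat list" where
  "row_step x = (\<lambda>(r, bs). case row_insert x r of
      (None, r') \<Rightarrow> (r', bs)
    | (Some y, r') \<Rightarrow> (r', bs @ [y]))"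

definition first_row :: "nat list \<Rightarrow> nat list" where
  "first_row xs = fst (fold row_step xs ([], []))"

definition bumps :: "nat list \<Rightarrow> nat list" where
  "bumps xs = snd (fold row_step xs ([], []))"

lemma first_row_Nil [simp]: "first_row [] = []"
  and bumps_Nil [simp]: "bumps [] = []"
  by (simp_all add: first_row_def bumps_def)

lemma first_row_snoc [simp]: "first_row (xs @ [x]) = snd (row_insert x (first_row xs))"
  by (auto simp: first_row_def row_step_def split: prod.splits option.splits)

lemma bumps_snoc [simp]:
  "bumps (xs @ [x]) = bumps xs @ (case fst (row_insert x (first_row xs)) of
     None \<Rightarrow> [] | Some y \<Rightarrow> [y])"
  by (auto simp: first_row_def bumps_def row_step_def split: prod.splits option.splits)

lemma row_insert_append_ge:
  "\<forall>y\<in>set r. y \<le> x \<Longrightarrow> row_insert x r = (None, r @ [x])"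
  by (induction r) auto

lemma row_insert_mset:
  "mset (snd (row_insert x r)) + (case fst (row_insert x r) of None \<Rightarrow> {#} | Some y \<Rightarrow> {#y#})
    = add_mset x (mset r)"
  by (induction r) (auto split: prod.splits option.splits)

lemma first_row_bumps_mset: "mset (first_row xs) + mset (bumps xs) = mset xs"
proof (induction xs rule: rev_induct)
  case Nil
  then show ?case by simp
next
  case (snoc x xs)
  have "mset (first_row (xs @ [x])) + mset (bumps (xs @ [x])) =
      (mset (snd (row_insert x (first_row xs))) +
        (case fst (row_insert x (first_row xs)) of None \<Rightarrow> {#} | Some y \<Rightarrow> {#y#})) + mset (bumps xs)"
    by (auto split: option.splits)
  then show ?case unfolding row_insert_mset using snoc.IH by simp
qed

lemma set_first_row_bumps: "set (first_row xs) \<union> set (bumps xs) = set xs"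
  by (metis first_row_bumps_mset set_mset_mset set_mset_union)

lemma distinct_first_row_bumps: "distinct xs \<Longrightarrow> set (first_row xs) \<inter> set (bumps xs) = {}"
proof -
  assume "distinct xs"
  then have "distinct (first_row xs @ bumps xs)"
    by (metis first_row_bumps_mset mset_append mset_eq_imp_distinct_iff)
  then show ?thesis by simp
qed

text \<open>
  The rows below the first are the insertion tableau of the sequence of bumped entries.
\<close>
lemma tableau_first_row:
  "xs \<noteq> [] \<Longrightarrow> fold tableau_insert xs [] = first_row xs # fold tableau_insert (bumps xs) []"
proof (induction xs rule: rev_induct)
  case Nil
  then show ?case by simp
next
  case (snoc x xs)
  show ?case
  proof (cases "xs = []")
    case True
    then show ?thesis using first_row_snoc[of "[]" x] bumps_snoc[of "[]" x] by simp
  next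
    case False
    then show ?thesis using snoc.IH by (auto split: prod.splits option.splits)
  qed
qed

text \<open>
  No entry is bumped from the second row when the entries arrive in increasing order, so there is
  no third row and the second row is the sequence of bumped entries itself.
\<close>
lemma tableau_sorted:
  "sorted bs \<Longrightarrow> fold tableau_insert bs [] = (if bs = [] then [] else [bs])"
proof (induction bs rule: rev_induct)
  case Nil
  then show ?case by simp
next
  case (snoc x bs)
  then show ?case using row_insert_append_ge[of bs x] by (auto simp: sorted_append)
qed

lemma Row2_eq_bumps:
  assumes "sorted (bumps xs)"
  shows "Row2 (fold tableau_insert xs []) = set (bumps xs)"
  using tableau_first_row[of xs] tableau_sorted[OF assms]
  by (cases "xs = []") (auto simp: Row2_def)

definition ends_with_bump :: "nat list \<Rightarrow> bool" where
  "ends_with_bump xs \<longleftrightarrow> bumps xs \<noteq> bumps (butlast xs)"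

text \<open>
  A large entry at the end of the row is bumped exactly if nothing before it is.
\<close>
lemma row_insert_append_max:
  assumes "x < y"
  shows "row_insert x (r @ [y]) = (case row_insert x r of
      (None, r') \<Rightarrow> (Some y, r @ [x])
    | (Some z, r') \<Rightarrow> (Some z, r' @ [y]))"
  using assms by (induction r) (auto split: prod.splits option.splits)

lemma bumps_append_max:
  assumes "\<forall>x\<in>set xs. x \<le> y"
  shows "bumps (xs @ [y]) = bumps xs" "\<not> ends_with_bump (xs @ [y])"
    "first_row (xs @ [y]) = first_row xs @ [y]"
proof -
  have "\<forall>x\<in>set (first_row xs). x \<le> y" using assms set_first_row_bumps[of xs] by blast
  then have "row_insert y (first_row xs) = (None, first_row xs @ [y])"
    by (rule row_insert_append_ge)
  then show "bumps (xs @ [y]) = bumps xs" "\<not> ends_with_bump (xs @ [y])"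
    "first_row (xs @ [y]) = first_row xs @ [y]"
    by (simp_all add: ends_with_bump_def)
qed

text \<open>
  Inserting \<open>y\<close> first only extends the row at the end. The entry \<open>m\<close> then bumps what it would have
  bumped without \<open>y\<close>, or else \<open>y\<close> itself.
\<close>
lemma bumps_max_before_last:
  assumes "\<forall>x\<in>set xs. x \<le> y" "m < y"
  shows "bumps (xs @ [y, m])
      = (if ends_with_bump (xs @ [m]) then bumps (xs @ [m]) else bumps (xs @ [m]) @ [y])"
    and "ends_with_bump (xs @ [y, m])"
proof -
  have e: "xs @ [y, m] = (xs @ [y]) @ [m]" by simp
  have b: "bumps (xs @ [y, m]) = bumps xs @ (case fst (row_insert m (first_row xs)) of
      None \<Rightarrow> [y] | Some z \<Rightarrow> [z])"
    unfolding e bumps_snoc[of "xs @ [y]"] bumps_append_max[OF assms(1)]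
      row_insert_append_max[OF assms(2)]
    by (auto split: prod.splits option.splits)
  show "bumps (xs @ [y, m])
      = (if ends_with_bump (xs @ [m]) then bumps (xs @ [m]) else bumps (xs @ [m]) @ [y])"
    unfolding b ends_with_bump_def by (auto split: option.splits)
  have "butlast (xs @ [y, m]) = xs @ [y]" by (simp add: butlast_append)
  then show "ends_with_bump (xs @ [y, m])"
    unfolding ends_with_bump_def b using bumps_append_max(1)[OF assms(1)]
    by (auto split: option.splits)
qed

lemma row_insert_map:
  assumes "strict_mono f"
  shows "row_insert (f x) (map f r) = map_prod (map_option f) (map f) (row_insert x r)"
  by (induction r) (auto simp: strict_mono_less[OF assms] split: prod.splits)

lemma bumps_map:
  assumes "strict_mono f"
  shows "first_row (map f xs) = map f (first_row xs) \<and> bumps (map f xs) = map f (bumps xs)"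
  by (induction xs rule: rev_induct)
    (auto simp: row_insert_map[OF assms] option.case_eq_if map_option_case split: option.splits)

lemma strict_mono_lift_from: "strict_mono (lift_from n)"
  by (auto simp: strict_mono_def lift_from_def)

lemma row_insert_below_max:
  assumes "set r \<subseteq> {..<n} \<union> {Suc n}"
  shows "fst (row_insert n r) = (if Suc n \<in> set r then Some (Suc n) else None)"
  using assms by (induction r) (auto split: prod.splits)

lemma map_lift_from_id: "set xs \<subseteq> {..<n} \<Longrightarrow> map (lift_from n) xs = xs"
  by (induction xs) (auto simp: lift_from_def)

text \<open>
  Renaming \<open>n\<close> to \<open>n + 1\<close> does not affect the course of the insertion. The additional entry \<open>n\<close>
  can bump only \<open>n + 1\<close>, which it finds in the first row unless \<open>n\<close> was bumped before the renaming.
\<close>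
lemma bumps_swap_top_values:
  assumes "set xs = {1..n}" "distinct xs" "0 < n"
  shows "bumps (map (lift_from n) xs @ [n])
      = (if n \<in> set (bumps xs) then map (lift_from n) (bumps xs) else bumps xs @ [Suc n])"
    and "ends_with_bump (map (lift_from n) xs @ [n]) \<longleftrightarrow> n \<notin> set (bumps xs)"
proof -
  let ?f = "lift_from n"
  have sub: "set (first_row xs) \<subseteq> {..n}" "set (bumps xs) \<subseteq> {..n}"
    using set_first_row_bumps[of xs] assms(1) by auto
  have "n \<in> set xs" using assms by simp
  then have n: "n \<in> set (first_row xs) \<longleftrightarrow> n \<notin> set (bumps xs)"
    using set_first_row_bumps[of xs] distinct_first_row_bumps[OF assms(2)] by blast
  have "set (map ?f (first_row xs)) \<subseteq> {..<n} \<union> {Suc n}"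
    and "Suc n \<in> set (map ?f (first_row xs)) \<longleftrightarrow> n \<in> set (first_row xs)"
    using sub(1) by (force simp: lift_from_def image_iff split: if_splits)+
  then have ins: "fst (row_insert n (map ?f (first_row xs)))
      = (if n \<in> set (bumps xs) then None else Some (Suc n))"
    using row_insert_below_max[of "map ?f (first_row xs)" n] n by auto
  have b: "bumps (map ?f xs @ [n])
      = map ?f (bumps xs) @ (if n \<in> set (bumps xs) then [] else [Suc n])"
    using ins bumps_map[OF strict_mono_lift_from, of n xs] by simp
  show "ends_with_bump (map ?f xs @ [n]) \<longleftrightarrow> n \<notin> set (bumps xs)"
    unfolding ends_with_bump_def b using bumps_map[OF strict_mono_lift_from, of n xs] by simp
  have "map ?f (bumps xs) = bumps xs" if "n \<notin> set (bumps xs)"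
    using that sub(2) by (intro map_lift_from_id) (metis atMost_iff le_neq_implies_less lessThan_iff subset_iff)
  then show "bumps (map ?f xs @ [n])
      = (if n \<in> set (bumps xs) then map ?f (bumps xs) else bumps xs @ [Suc n])"
    unfolding b by simp
qed

text \<open>
  Each move keeps the bumped entries, renames them monotonically or adds the new maximum at the end.
\<close>
lemma bool_word_sorted_bumps: "bool_word n xs \<Longrightarrow> sorted (bumps xs)"
proof (induction rule: bool_word.induct)
  case single
  then show ?case using bumps_append_max(1)[of "[]" 1] by simp
next
  case (append_max n xs)
  then show ?case using bumps_append_max(1)[of xs "Suc n"] bool_word_letters by fastforce
next
  case (max_before_last n xs m)
  have l: "set (xs @ [m]) = {1..n}" using bool_word_letters max_before_last.hyps by blast
  have l': "\<forall>x\<in>set xs. x \<le> Suc n" "m < Suc n"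
    using bool_word_le[OF max_before_last.hyps] by (auto simp: le_SucI less_Suc_eq_le)
  have "set (bumps (xs @ [m])) \<subseteq> {1..n}" using set_first_row_bumps[of "xs @ [m]"] l by blast
  then have "sorted (bumps (xs @ [m]) @ [Suc n])"
    using max_before_last.IH unfolding sorted_append by fastforce
  then show ?case using max_before_last.IH unfolding bumps_max_before_last(1)[OF l'] by simp
next
  case (swap_top_values n xs)
  have l: "set xs = {1..n}" "distinct xs" "0 < n"
    using bool_word_letters bool_word_pos swap_top_values.hyps by blast+
  have "set (bumps xs) \<subseteq> {1..n}" using set_first_row_bumps[of xs] l by blast
  then have "sorted (bumps xs @ [Suc n])"
    using swap_top_values.IH unfolding sorted_append by fastforce
  moreover have "sorted (map (lift_from n) (bumps xs))"
    using swap_top_values.IH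
    by (auto simp: sorted_map lift_from_def elim!: sorted_wrt_mono_rel[rotated])
  ultimately show ?case unfolding bumps_swap_top_values(1)[OF l] by simp
qed

section \<open>Which sets of bumped entries occur\<close>

lemma surplus_insert_above: "n < m \<Longrightarrow> surplus (insert m Y) n = surplus Y n"
  by (intro surplus_cong) auto

lemma row_insert_bumps_greater: "fst (row_insert x r) = Some y \<Longrightarrow> x < y"
  by (induction r) (auto split: prod.splits if_splits)

lemma bumps_greater: "y \<in> set (bumps xs) \<Longrightarrow> \<exists>x\<in>set xs. x < y"
  by (induction xs rule: rev_induct)
    (auto split: option.splits dest: row_insert_bumps_greater[OF sym] row_insert_bumps_greater)

lemma bumps_subset:
  assumes "bool_word n xs"
  shows "set (bumps xs) \<subseteq> {2..n}"
proof
  fix y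
  assume y: "y \<in> set (bumps xs)"
  then have "y \<in> set xs" using set_first_row_bumps by blast
  then have "y \<le> n" using bool_word_letters[OF assms] by simp
  moreover obtain x where "x \<in> set xs" "x < y" using bumps_greater[OF y] by blast
  ultimately show "y \<in> {2..n}" using bool_word_letters[OF assms] by simp
qed

text \<open>
  The bound at \<open>n\<close> for words without a final bump is needed for the induction: from such a word,
  \<open>max_before_last\<close> adds \<open>n + 1\<close> to the bumped entries and so raises the surplus. The
  move \<open>swap_top_values\<close> raises it if \<open>n\<close> was not bumped; in that case the surplus has just dropped
  to at most \<open>1\<close>, or \<open>n = 1\<close>.
\<close>
lemma surplus_of_bool_word:
  assumes "bool_word n xs"
  shows "(\<forall>k\<le>n. surplus (insert 1 (set (bumps xs))) k \<le> 2) \<and>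
    (\<not> ends_with_bump xs \<longrightarrow> surplus (insert 1 (set (bumps xs))) n \<le> 1)"
  using assms
proof (induction rule: bool_word.induct)
  case single
  then show ?case using bumps_append_max(1)[of "[]" 1] by (auto simp: le_Suc_eq)
next
  case (append_max n xs)
  have b: "bumps (xs @ [Suc n]) = bumps xs"
    using bumps_append_max(1)[of xs "Suc n"] bool_word_letters[OF append_max.hyps] by fastforce
  have "Suc n \<notin> insert 1 (set (bumps xs))"
    using bumps_subset[OF append_max.hyps] bool_word_pos[OF append_max.hyps] by auto
  then show ?case using append_max.IH unfolding b by (auto simp: le_Suc_eq)
next
  case (max_before_last n xs m)
  have l': "\<forall>x\<in>set xs. x \<le> Suc n" "m < Suc n"
    using bool_word_le[OF max_before_last.hyps] by (auto simp: le_SucI less_Suc_eq_le)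
  let ?Y = "insert 1 (set (bumps (xs @ [m])))"
  have notin: "Suc n \<notin> ?Y"
    using bumps_subset[OF max_before_last.hyps] bool_word_pos[OF max_before_last.hyps] by auto
  show ?case
  proof (cases "ends_with_bump (xs @ [m])")
    case True
    then have "bumps (xs @ [Suc n, m]) = bumps (xs @ [m])"
      using bumps_max_before_last(1)[OF l'] by simp
    then show ?thesis
      using max_before_last.IH notin bumps_max_before_last(2)[OF l'] by (auto simp: le_Suc_eq)
  next
    case False
    then have Y: "insert 1 (set (bumps (xs @ [Suc n, m]))) = insert (Suc n) ?Y"
      using bumps_max_before_last(1)[OF l'] by auto
    show ?thesis
      unfolding Y using max_before_last.IH False bumps_max_before_last(2)[OF l']
      by (auto simp: le_Suc_eq surplus_insert_above)
  qed
next
  case (swap_top_values n xs)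
  have l: "set xs = {1..n}" "distinct xs" "0 < n"
    using bool_word_letters bool_word_pos swap_top_values.hyps by blast+
  let ?Y = "insert 1 (set (bumps xs))"
  have sub: "set (bumps xs) \<subseteq> {2..n}" by (rule bumps_subset[OF swap_top_values.hyps])
  obtain p where p: "n = Suc p" using l(3) gr0_conv_Suc by blast
  show ?case
  proof (cases "n \<in> set (bumps xs)")
    case False
    have "surplus ?Y n \<le> 1"
    proof (cases "n = 1")
      case True
      then show ?thesis by simp
    next
      case ne: False
      have "surplus ?Y p \<le> 2" using swap_top_values.IH p by simp
      then show ?thesis using False ne p by simp
    qed
    moreover have "insert 1 (set (bumps (map (lift_from n) xs @ [n]))) = insert (Suc n) ?Y"
      using bumps_swap_top_values(1)[OF l] False by auto
    moreover have "ends_with_bump (map (lift_from n) xs @ [n])"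
      using bumps_swap_top_values(2)[OF l] False by blast
    ultimately show ?thesis
      using swap_top_values.IH by (auto simp: le_Suc_eq surplus_insert_above)
  next
    case True
    \<comment> \<open>Taking \<open>n\<close> out of the set turns the rise from \<open>n - 1\<close> to \<open>n\<close> into a drop. As the surplus is
      at most \<open>1\<close> at \<open>n - 1\<close>, it becomes \<open>0\<close> at \<open>n\<close>, and \<open>1\<close> at \<open>n + 1\<close>.\<close>
    let ?Z = "insert 1 (set (map (lift_from n) (bumps xs)))"
    have n2: "2 \<le> n" using True sub by auto
    have low: "lift_from n ` set (bumps xs) = insert (Suc n) (set (bumps xs) - {n})"
    proof -
      have "lift_from n x = (if x = n then Suc n else x)" if "x \<in> set (bumps xs)" for x
        using that sub by (force simp: lift_from_def)
      then show ?thesis using True by (auto simp: image_iff)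
    qed
    have same: "surplus ?Z k = surplus ?Y k" if "k \<le> p" for k
      using that p low by (intro surplus_cong) auto
    have "surplus ?Y n = Suc (surplus ?Y p)" using True p by simp
    moreover have "surplus ?Y n \<le> 2" using swap_top_values.IH by blast
    ultimately have "surplus ?Z p \<le> 1" using same[of p] by simp
    moreover have "n \<notin> ?Z" "Suc n \<in> ?Z" using low n2 by auto
    ultimately have "surplus ?Z n = 0" "surplus ?Z (Suc n) = 1" using p by simp_all
    moreover have "surplus ?Z k \<le> 2" if "k \<le> p" for k
      using same[OF that] swap_top_values.IH that p by simp
    ultimately have "(\<forall>k\<le>Suc n. surplus ?Z k \<le> 2) \<and> surplus ?Z (Suc n) \<le> 1"
      unfolding le_Suc_eq p by auto
    then show ?thesis
      using bumps_swap_top_values(1)[OF l] True by simp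
  qed
qed

text \<open>
  The move that produces \<open>X\<close> can be read off at the top. If \<open>n + 1 \<notin> X\<close>, append \<open>n + 1\<close>. If
  \<open>n + 1 \<in> X\<close>, the surplus at \<open>n\<close> is \<open>0\<close> or \<open>1\<close>. If it is \<open>1\<close>, a word for \<open>X - {n + 1}\<close> without a final
  bump exists, and \<open>n + 1\<close> is inserted before its last entry. If it is \<open>0\<close>, then \<open>n \<notin> X\<close>, and
  the word for \<open>X\<close> must avoid a final bump: exchange \<open>n + 1\<close> for \<open>n\<close> in \<open>X\<close>, which keeps the surplus
  at most \<open>2\<close>, and apply \<open>swap_top_values\<close> to a word for the resulting set.
\<close>
lemma bool_word_of_surplus:
  assumes "0 < n" "X \<subseteq> {2..n}" "\<forall>k\<le>n. surplus (insert 1 X) k \<le> 2"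
  shows "\<exists>xs. bool_word n xs \<and> set (bumps xs) = X \<and>
    (surplus (insert 1 X) n \<le> 1 \<longrightarrow> \<not> ends_with_bump xs)"
  using assms
proof (induction n arbitrary: X)
  case 0
  then show ?case by simp
next
  case (Suc n)
  show ?case
  proof (cases "n = 0")
    case True
    then have "X = {}" using Suc.prems by auto
    then show ?thesis
      using True bool_word.single bumps_append_max(1,2)[of "[]" 1]
      by (intro exI[of _ "[1]"]) simp
  next
    case n: False
    show ?thesis
    proof (cases "Suc n \<in> X")
      case False
      then have "X \<subseteq> {2..n}" using Suc.prems(2) by (force simp: le_Suc_eq)
      then obtain xs where xs: "bool_word n xs" "set (bumps xs) = X"
        using Suc.IH[of X] Suc.prems(3) n by auto
      have "\<forall>x\<in>set xs. x \<le> Suc n" using bool_word_letters[OF xs(1)] by auto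
      then show ?thesis
        using xs bumps_append_max[of xs "Suc n"] bool_word.append_max[OF xs(1)] by metis
    next
      case top: True
      define X' where "X' = X - {Suc n}"
      have X: "X = insert (Suc n) X'" using top by (auto simp: X'_def)
      have X': "X' \<subseteq> {2..n}" using Suc.prems(2) by (force simp: le_Suc_eq X'_def)
      have same: "surplus (insert 1 X) k = surplus (insert 1 X') k" if "k \<le> n" for k
        using that by (intro surplus_cong) (auto simp: X)
      have bound: "surplus (insert 1 X') k \<le> 2" if "k \<le> n" for k
        using Suc.prems(3) same that by (metis le_SucI)
      have total: "surplus (insert 1 X) (Suc n) = Suc (surplus (insert 1 X') n)"
        using same[of n] top by simp
      moreover have "surplus (insert 1 X) (Suc n) \<le> 2" using Suc.prems(3) by blast
      ultimately consider "surplus (insert 1 X') n = 1" | "surplus (insert 1 X') n = 0"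
        by linarith
      then show ?thesis
      proof cases
        case 1
        then obtain xs where xs: "bool_word n xs" "set (bumps xs) = X'" "\<not> ends_with_bump xs"
          using Suc.IH[of X'] X' bound n by auto
        have "set xs = {1..n}" using bool_word_letters[OF xs(1)] by blast
        then have "xs \<noteq> []" using n by auto
        then obtain v m where v: "xs = v @ [m]" by (metis rev_exhaust)
        have l: "\<forall>x\<in>set v. x \<le> Suc n" "m < Suc n"
          using bool_word_le[OF xs(1)] v by (auto simp: le_SucI less_Suc_eq_le)
        have "set (bumps (v @ [Suc n, m])) = X"
          using xs v X bumps_max_before_last(1)[OF l] by simp
        moreover have "bool_word (Suc n) (v @ [Suc n, m])"
          using xs(1) v bool_word.max_before_last by blast
        ultimately show ?thesis using total 1 by auto
      next
        case 2
        obtain p where p: "n = Suc p" using n not0_implies_Suc by blast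
        have out: "n \<notin> insert 1 X'" using 2 p by (metis nat.distinct(1) surplus.simps(2))
        then have n2: "2 \<le> n" using n by auto
        define X'' where "X'' = insert n X'"
        have same': "surplus (insert 1 X'') k = surplus (insert 1 X') k" if "k \<le> p" for k
          using that p by (intro surplus_cong) (auto simp: X''_def)
        have "surplus (insert 1 X') p \<le> 1" using 2 out p by simp
        then have "surplus (insert 1 X'') n \<le> 2" using same'[of p] p by (simp add: X''_def)
        then have "\<forall>k\<le>n. surplus (insert 1 X'') k \<le> 2"
          using same' bound p by (metis le_Suc_eq)
        moreover have "X'' \<subseteq> {2..n}" using X' n2 by (auto simp: X''_def)
        ultimately obtain xs where xs: "bool_word n xs" "set (bumps xs) = X''"
          using Suc.IH[of X''] n by auto
        have l: "set xs = {1..n}" "distinct xs" "0 < n" using bool_word_letters[OF xs(1)] n by auto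
        have mem: "n \<in> set (bumps xs)" using xs(2) by (simp add: X''_def)
        have "lift_from n x = x" if "x \<in> X'" for x
        proof -
          have "x \<le> n" "x \<noteq> n" using that X' out by auto
          then show ?thesis by (simp add: lift_from_def)
        qed
        then have "lift_from n ` X' = X'" by auto
        then have "lift_from n ` X'' = X" by (simp add: X''_def X lift_from_def)
        then have "set (bumps (map (lift_from n) xs @ [n])) = X"
          using bumps_swap_top_values(1)[OF l] mem xs(2) by simp
        then show ?thesis
          using bool_word.swap_top_values[OF xs(1)] bumps_swap_top_values(2)[OF l] mem by blast
      qed
    qed
  qed
qed

lemma surplus_beyond:
  assumes "Y \<subseteq> {..n}" "\<forall>k\<le>n. surplus Y k \<le> c"
  shows "surplus Y k \<le> c"
proof (induction k)
  case 0
  then show ?case by simp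
next
  case (Suc k)
  show ?case
  proof (cases "Suc k \<le> n")
    case True
    then show ?thesis using assms(2) by blast
  next
    case False
    then have "Suc k \<notin> Y" using assms(1) by auto
    then show ?thesis using Suc by simp
  qed
qed

theorem corollary5p4:
  fixes n :: nat and X :: "nat set" and L :: "int set"
  assumes "X \<subseteq> {2..n}"
    and "L = {int x - 1 | x. x \<in> X}"
  shows "(\<exists>w. boolean_perm n w \<and> X = Row2 (insertion_tableau n w)) \<longleftrightarrow> uncrowded (L \<union> {0})"
proof -
  let ?Y = "insert 1 X"
  have "L \<union> {0} = (\<lambda>x. int x - 1) ` ?Y" using assms(2) by auto
  moreover have "0 \<notin> ?Y" using assms(1) by auto
  ultimately have u: "uncrowded (L \<union> {0}) \<longleftrightarrow> (\<forall>k. surplus ?Y k \<le> 2)"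
    by (metis uncrowded_iff_surplus_le_2)
  show ?thesis
  proof (cases "n = 0")
    case True
    then have X: "X = {}" using assms(1) by auto
    have "surplus {1} k \<le> 2" for k
      by (rule surplus_beyond[of _ 1]) (auto simp: le_Suc_eq)
    moreover have "boolean_perm n id"
      unfolding boolean_perm_iff_distinct_word by (intro exI[of _ "[]"]) simp
    moreover have "Row2 (insertion_tableau n id) = {}"
      using True by (simp add: insertion_tableau_def Row2_def)
    ultimately show ?thesis using u X by auto
  next
    case False
    have "(\<exists>w. boolean_perm n w \<and> X = Row2 (insertion_tableau n w))
        \<longleftrightarrow> (\<exists>xs. bool_word n xs \<and> X = Row2 (fold tableau_insert xs []))"
      using False by (auto simp: bool_word_iff_boolean_perm insertion_tableau_def)
    also have "\<dots> \<longleftrightarrow> (\<exists>xs. bool_word n xs \<and> X = set (bumps xs))"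
      using Row2_eq_bumps bool_word_sorted_bumps by metis
    also have "\<dots> \<longleftrightarrow> (\<forall>k\<le>n. surplus ?Y k \<le> 2)"
      using surplus_of_bool_word bool_word_of_surplus[of n X] assms(1) False by blast
    also have "\<dots> \<longleftrightarrow> (\<forall>k. surplus ?Y k \<le> 2)"
      using surplus_beyond[of ?Y n 2] assms(1) False by fastforce
    finally show ?thesis using u by blast
  qed
qed

end
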